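(* For every integer $k\ge4$ there exists a discrete probability distribution $P=(a_1/m,\dots,a_n/m)$, with $a_i$ coprime positive integers and $\lceil\log m\rceil=k$ (so that $\mathrm{FLDR}[P]$ has depth $k$), such that the entropy tolls satisfy $\tau(\mathrm{ALDR}[P,K])>2$ for every $K\in\{k,k+1,\dots,2k-1\}$.
   Context: All logarithms are base 2; $H(P)$ is Shannon entropy. For real $x\ge0$ and integer $d$, $\epsilon_d(x)=\lfloor 2^d x\rfloor\bmod 2$, $\nu(x)=\sum_d d\,\epsilon_d(x)2^{-d}$. A DDG tree is a sampler driven by i.i.d. fair bits: a binary tree (possibly with back edges to the root) with labeled leaves, traversed from the root one fair bit per step until a leaf is reached, whose label is output. $C(T)$ is the number of bits consumed; toll $\tau(T)=\mathbb{E}[C(T)]-H(P_T)$, $P_T$ the output distribution. FLDR: for positive integers $A_1,\dots,A_n$ with sum $M$, $K'=\lceil\log M\rceil$, $A_0=2^{K'}-M$, $Q=(A_0/2^{K'},\dots,A_n/2^{K'})$; $\mathrm{FLDR}[A_1,\dots,A_n]$ is an entropy-optimal DDG tree for $Q$ (exactly $\epsilon_d(A_i/2^{K'})$ leaves labeled $i$ at depth $d$) with each leaf labeled $0$ replaced by a back edge to the root; output distribution $(A_i/M)$, expected cost $(2^{K'}/M)\sum_{i=0}^n\nu(A_i/2^{K'})$. For $P=(a_i/m)$ with $\gcd(a_1,\dots,a_n)=1$, $m=\sum a_i$, $k=\lceil\log m\rceil$ and integer $K\ge k$: $c_K=\lfloor 2^K/m\rfloor$, $\mathrm{ALDR}[P,K]=\mathrm{FLDR}[c_Ka_1,\dots,c_Ka_n]$,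 and $\mathrm{FLDR}[P]=\mathrm{FLDR}[a_1,\dots,a_n]=\mathrm{ALDR}[P,k]$. *)

theory Defs
  imports "HOL-Probability.Probability"
begin

text \<open>
  A finite binary tree whose frontier consists of labelled leaves and of edges back to the root:
  a child \<open>Back\<close> stands for an edge from its parent node to the root of the whole tree.
\<close>

datatype (labels: 'a) ddg = Leaf 'a | Back | Node "'a ddg" "'a ddg"

primrec height :: "'a ddg \<Rightarrow> nat" where
  "height (Leaf i) = 0"
| "height Back = 0"
| "height (Node l r) = Suc (max (height l) (height r))"

primrec back_free :: "'a ddg \<Rightarrow> bool" where
  "back_free (Leaf i) \<longleftrightarrow> True"
| "back_free Back \<longleftrightarrow> False"
| "back_free (Node l r) \<longleftrightarrow> back_free l \<and> back_free r"

text \<open>\<open>leaf_count T d i\<close> is the number of leaves of \<open>T\<close> at depth \<open>d\<close> with label \<open>i\<close>.\<close>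

primrec leaf_count :: "'a ddg \<Rightarrow> nat \<Rightarrow> 'a \<Rightarrow> nat" where
  "leaf_count (Leaf j) d i = (if d = 0 \<and> i = j then 1 else 0)"
| "leaf_count Back d i = 0"
| "leaf_count (Node l r) d i =
     (case d of 0 \<Rightarrow> 0 | Suc e \<Rightarrow> leaf_count l e i + leaf_count r e i)"

subsection \<open>Traversal by fair bits\<close>

abbreviation coins :: "bool stream measure" where
  "coins \<equiv> stream_space (measure_pmf (bernoulli_pmf (1/2)))"

text \<open>One step below the root \<open>T\<close>; a leaf is absorbing.\<close>

fun descend :: "'a ddg \<Rightarrow> 'a ddg \<Rightarrow> bool \<Rightarrow> 'a ddg" where
  "descend T (Leaf i) b = Leaf i"
| "descend T Back b = T"
| "descend T (Node l r) b = (let u = (if b then r else l) in if u = Back then T else u)"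

definition position :: "'a ddg \<Rightarrow> bool stream \<Rightarrow> nat \<Rightarrow> 'a ddg" where
  "position T \<omega> n = foldl (descend T) T (stake n \<omega>)"

text \<open>The number of bits consumed; it is \<open>\<infinity>\<close> if no leaf is ever reached.\<close>

definition cost :: "'a ddg \<Rightarrow> bool stream \<Rightarrow> enat" where
  "cost T \<omega> = Inf {enat n | n. \<exists>i. position T \<omega> n = Leaf i}"

definition expected_cost :: "'a ddg \<Rightarrow> ennreal" where
  "expected_cost T = (\<integral>\<^sup>+ \<omega>. ennreal_of_enat (cost T \<omega>) \<partial>coins)"

definition output_prob :: "'a ddg \<Rightarrow> 'a \<Rightarrow> real" where
  "output_prob T i = measure coins {\<omega>. \<exists>n. position T \<omega> n = Leaf i}"

text \<open>The convention \<open>0 log 0 = 0\<close> holds because \<open>0 * x = 0\<close>.\<close>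

definition shannon_entropy :: "'a set \<Rightarrow> ('a \<Rightarrow> real) \<Rightarrow> real" where
  "shannon_entropy S p = - (\<Sum>i\<in>S. p i * log 2 (p i))"

definition toll :: "'a ddg \<Rightarrow> ereal" where
  "toll T = enn2ereal (expected_cost T) - ereal (shannon_entropy (labels T) (output_prob T))"

subsection \<open>Entropy-optimal trees, FLDR and ALDR\<close>

definition binary_digit :: "int \<Rightarrow> real \<Rightarrow> int" where
  "binary_digit d x = \<lfloor>2 powi d * x\<rfloor> mod 2"

definition entropy_optimal :: "real list \<Rightarrow> nat ddg \<Rightarrow> bool" where
  "entropy_optimal q T \<longleftrightarrow>
     back_free T \<and> labels T \<subseteq> {..<length q} \<and>
     (\<forall>i<length q. \<forall>d. int (leaf_count T d i) = binary_digit (int d) (q ! i))"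

primrec restart_at :: "'a \<Rightarrow> 'a ddg \<Rightarrow> 'a ddg" where
  "restart_at j (Leaf i) = (if i = j then Back else Leaf i)"
| "restart_at j Back = Back"
| "restart_at j (Node l r) = Node (restart_at j l) (restart_at j r)"

text \<open>
  The distribution \<open>Q\<close>: the entry with index \<open>0\<close> is the rejection probability, and the entry
  with index \<open>i \<ge> 1\<close> belongs to the \<open>i\<close>-th weight of the list.
\<close>

definition fldr_proposal :: "nat list \<Rightarrow> real list" where
  "fldr_proposal ws =
     (let M = sum_list ws; K = nat \<lceil>log 2 (real M)\<rceil>
      in map (\<lambda>a. real a / 2 ^ K) ((2 ^ K - M) # ws))"

text \<open>
  Entropy-optimal trees are not unique, so \<open>FLDR\<close> and \<open>ALDR\<close> are the sets of all trees that
  arise from some choice of the entropy-optimal tree.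
\<close>

definition FLDR :: "nat list \<Rightarrow> nat ddg set" where
  "FLDR ws = restart_at 0 ` {T. entropy_optimal (fldr_proposal ws) T}"

definition ALDR :: "nat list \<Rightarrow> nat \<Rightarrow> nat ddg set" where
  "ALDR ws K = FLDR (map (\<lambda>a. (2 ^ K div sum_list ws) * a) ws)"

subsection \<open>Existence of the trees\<close>

lemma forest_exists:
  fixes L :: "nat \<Rightarrow> 'a multiset"
  assumes "(\<Sum>d\<le>K. size (L d) * 2 ^ (K - d)) = N * 2 ^ K"
  shows "\<exists>ts. length ts = N \<and> (\<forall>t\<in>set ts. back_free t) \<and>
           (\<forall>d i. (\<Sum>t\<leftarrow>ts. leaf_count t d i) = (if d \<le> K then count (L d) i else 0))"
  using assms
proof (induction K arbitrary: L N)
  case 0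
  obtain xs where xs: "mset xs = L 0" using ex_mset by blast
  have "(\<Sum>t\<leftarrow>map Leaf xs. leaf_count t d i) = (if d \<le> 0 then count (mset xs) i else 0)" for d i
    by (induction xs) auto
  moreover have "length xs = N" using 0 by (simp flip: xs)
  ultimately show ?case using xs
    by (intro exI[of _ "map Leaf xs"]) auto
next
  case (Suc K)
  let ?n = "N - size (L 0)"
  have split: "(\<Sum>d\<le>Suc K. size (L d) * 2 ^ (Suc K - d))
      = size (L 0) * 2 ^ Suc K + (\<Sum>d\<le>K. size (L (Suc d)) * 2 ^ (K - d))"
    by (subst sum.atMost_Suc_shift) simp
  then have "size (L 0) * 2 ^ Suc K \<le> N * 2 ^ Suc K" using Suc.prems by linarith
  then have le: "size (L 0) \<le> N" by simp
  have "(\<Sum>d\<le>K. size (L (Suc d)) * 2 ^ (K - d)) = (2 * ?n) * 2 ^ K"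
    using split Suc.prems le by (simp add: diff_mult_distrib diff_mult_distrib2)
  from Suc.IH[of "\<lambda>d. L (Suc d)", OF this] obtain ts where ts: "length ts = 2 * ?n"
    "\<forall>t\<in>set ts. back_free t"
    "\<forall>d i. (\<Sum>t\<leftarrow>ts. leaf_count t d i) = (if d \<le> K then count (L (Suc d)) i else 0)"
    by blast
  obtain xs where xs: "mset xs = L 0" using ex_mset by blast
  define us where "us = map2 Node (take ?n ts) (drop ?n ts)"
  have sum_us: "(\<Sum>t\<leftarrow>map2 Node as bs. leaf_count t (Suc d) i)
      = (\<Sum>t\<leftarrow>as @ bs. leaf_count t d i)"
    if "length as = length bs" for as bs :: "'a ddg list" and d i
    using that by (induction as bs rule: list_induct2) auto
  have sum_us0: "(\<Sum>t\<leftarrow>map2 Node as bs. leaf_count t 0 i) = 0"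
    if "length as = length bs" for as bs :: "'a ddg list" and i
    using that by (induction as bs rule: list_induct2) auto
  have len: "length (take ?n ts) = length (drop ?n ts)" using ts(1) by simp
  have leafs: "(\<Sum>t\<leftarrow>map Leaf xs. leaf_count t d i) = (if d = 0 then count (L 0) i else 0)" for d i
    unfolding xs[symmetric] by (induction xs) auto
  have "(\<Sum>t\<leftarrow>map Leaf xs @ us. leaf_count t d i) = (if d \<le> Suc K then count (L d) i else 0)" for d i
  proof (cases d)
    case 0
    then show ?thesis
      using leafs[of 0 i] sum_us0[OF len, of i] by (simp add: us_def)
  next
    case (Suc e)
    have "(\<Sum>t\<leftarrow>us. leaf_count t (Suc e) i) = (\<Sum>t\<leftarrow>ts. leaf_count t e i)"
      unfolding us_def sum_us[OF len] by (simp only: append_take_drop_id)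
    then show ?thesis
      using leafs[of d i] ts(3) Suc by simp
  qed
  moreover have "length (map Leaf xs @ us) = N"
    using ts(1) le by (simp add: us_def flip: xs)
  moreover have "\<forall>t\<in>set (map Leaf xs @ us). back_free t"
  proof -
    have "\<forall>t\<in>set (take ?n ts). back_free t" "\<forall>t\<in>set (drop ?n ts). back_free t"
      using ts(2) set_take_subset[of ?n ts] set_drop_subset[of ?n ts] by blast+
    then show ?thesis by (auto simp: us_def elim!: in_set_zipE)
  qed
  ultimately show ?case by blast
qed

lemma labels_leaf_count: "i \<in> labels T \<Longrightarrow> \<exists>d. leaf_count T d i > 0"
proof (induction T)
  case (Node l r)
  then consider d where "leaf_count l d i > 0" | d where "leaf_count r d i > 0" by auto
  then show ?case
  proof cases
    case (1 d)
    then show ?thesis by (intro exI[of _ "Suc d"]) simp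
  next
    case (2 d)
    then show ?thesis by (intro exI[of _ "Suc d"]) simp
  qed
qed auto

lemma binary_digit_dyadic:
  assumes "d \<le> K"
  shows "binary_digit (int d) (real a / 2 ^ K) = int (a div 2 ^ (K - d) mod 2)"
proof -
  have "(2::real) ^ K = 2 ^ d * 2 ^ (K - d)" using assms by (simp flip: power_add)
  then have "2 powi int d * (real a / 2 ^ K) = real a / real (2 ^ (K - d))"
    by simp
  then have "\<lfloor>2 powi int d * (real a / 2 ^ K)\<rfloor> = int (a div 2 ^ (K - d))"
    by (simp only: floor_divide_of_nat_eq)
  then show ?thesis unfolding binary_digit_def by (simp add: zmod_int)
qed

lemma binary_digit_dyadic_0:
  assumes "K < d"
  shows "binary_digit (int d) (real a / 2 ^ K) = 0"
proof -
  have "(2::real) ^ d = 2 ^ K * 2 ^ (d - K)" using assms by (simp flip: power_add)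
  then have "2 powi int d * (real a / 2 ^ K) = real_of_int (int (a * 2 ^ (d - K)))"
    by simp
  then have "\<lfloor>2 powi int d * (real a / 2 ^ K)\<rfloor> = int (a * 2 ^ (d - K))"
    by (simp only: floor_of_int)
  moreover have "even (a * 2 ^ (d - K))" using assms by simp
  ultimately show ?thesis unfolding binary_digit_def by presburger
qed

lemma binary_expansion:
  fixes a :: nat
  assumes "a < 2 ^ Suc K"
  shows "(\<Sum>d\<le>K. (a div 2 ^ (K - d) mod 2) * 2 ^ (K - d)) = a"
proof -
  have "(\<Sum>e\<le>K. (a div 2 ^ e mod 2) * 2 ^ e) = a mod 2 ^ Suc K" for K
  proof (induction K)
    case (Suc K)
    have "a mod (2 ^ Suc K * 2) = 2 ^ Suc K * (a div 2 ^ Suc K mod 2) + a mod 2 ^ Suc K"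
      by (rule mod_mult2_eq)
    then show ?case using Suc by (simp add: mult.commute)
  qed (simp add: mod_2_eq_odd)
  moreover have "(\<Sum>d\<le>K. (a div 2 ^ (K - d) mod 2) * 2 ^ (K - d))
      = (\<Sum>e\<le>K. (a div 2 ^ e mod 2) * 2 ^ e)"
    by (rule sum.nat_diff_reindex[of "\<lambda>e. (a div 2 ^ e mod 2) * 2 ^ e" "Suc K",
          simplified lessThan_Suc_atMost diff_Suc_Suc])
  ultimately show ?thesis using assms by simp
qed

lemma entropy_optimal_exists:
  fixes As :: "nat list"
  assumes "sum_list As = 2 ^ K"
  shows "\<exists>T. entropy_optimal (map (\<lambda>a. real a / 2 ^ K) As) T"
proof -
  let ?n = "length As"
  define b where "b d i = As ! i div 2 ^ (K - d) mod 2" for d i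
  define L where "L d = (\<Sum>i<?n. replicate_mset (b d i) i)" for d
  have cnt: "count (L d) i = (if i < ?n then b d i else 0)" for d i
    by (simp add: L_def count_sum)
  have "As ! i < 2 ^ Suc K" if "i < ?n" for i
  proof -
    have "As ! i \<le> 2 ^ K"
      using member_le_sum_list[OF nth_mem[OF that]] assms by simp
    also have "\<dots> < 2 ^ Suc K" by simp
    finally show ?thesis .
  qed
  then have "(\<Sum>i<?n. \<Sum>d\<le>K. b d i * 2 ^ (K - d)) = (\<Sum>i<?n. As ! i)"
    unfolding b_def by (intro sum.cong refl binary_expansion) auto
  also have "\<dots> = 2 ^ K" using assms by (simp add: sum_list_sum_nth atLeast0LessThan)
  finally have "(\<Sum>d\<le>K. size (L d) * 2 ^ (K - d)) = 1 * 2 ^ K"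
    by (subst (asm) sum.swap) (simp add: L_def sum_distrib_right)
  from forest_exists[OF this] obtain ts where ts: "length ts = 1" "\<forall>t\<in>set ts. back_free t"
    "\<forall>d i. (\<Sum>t\<leftarrow>ts. leaf_count t d i) = (if d \<le> K then count (L d) i else 0)" by blast
  then obtain T where T: "ts = [T]" by (auto simp: length_Suc_conv)
  have lc: "leaf_count T d i = (if d \<le> K \<and> i < ?n then b d i else 0)" for d i
    using ts(3) T cnt by auto
  have "labels T \<subseteq> {..<?n}"
  proof
    fix i assume "i \<in> labels T"
    then obtain d where "leaf_count T d i > 0" using labels_leaf_count[of i T] by auto
    then show "i \<in> {..<?n}" using lc[of d i] by (cases "i < ?n") auto
  qed
  moreover have "int (leaf_count T d i) = binary_digit (int d) (real (As ! i) / 2 ^ K)"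
    if "i < ?n" for d i
  proof (cases "d \<le> K")
    case True
    then show ?thesis unfolding binary_digit_dyadic[OF True] using that lc[of d i] b_def[of d i]
      by simp
  next
    case False
    then show ?thesis using lc[of d i] binary_digit_dyadic_0[of K d "As ! i"] by simp
  qed
  ultimately show ?thesis
    using ts(2) T unfolding entropy_optimal_def by (intro exI[of _ T]) auto
qed

lemma FLDR_nonempty:
  assumes "0 < sum_list ws"
  shows "FLDR ws \<noteq> {}"
proof -
  define K where "K = nat \<lceil>log 2 (real (sum_list ws))\<rceil>"
  have "log 2 (real (sum_list ws)) \<le> real K" unfolding K_def by linarith
  then have "real (sum_list ws) \<le> 2 powr real K" using assms by (simp add: log_le_iff)
  then have "sum_list ws \<le> 2 ^ K" by (simp add: powr_realpow)
  then have "sum_list ((2 ^ K - sum_list ws) # ws) = 2 ^ K" by simp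
  from entropy_optimal_exists[OF this] show ?thesis
    by (auto simp: FLDR_def fldr_proposal_def Let_def K_def)
qed

lemma ALDR_nonempty:
  assumes "0 < sum_list ws" "\<lceil>log 2 (real (sum_list ws))\<rceil> \<le> int K"
  shows "ALDR ws K \<noteq> {}"
proof -
  have "log 2 (real (sum_list ws)) \<le> real K" using assms(2) by linarith
  then have "real (sum_list ws) \<le> 2 powr real K" using assms by (simp add: log_le_iff)
  then have "sum_list ws \<le> 2 ^ K" by (simp add: powr_realpow)
  then have "0 < 2 ^ K div sum_list ws" using assms(1) by (simp add: div_greater_zero_iff)
  then show ?thesis unfolding ALDR_def using assms(1)
    by (intro FLDR_nonempty) (simp only: sum_list_const_mult nat_0_less_mult_iff map_ident)
qed

end

theory Submission
  imports Defs
begin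

text \<open>
  The witness is the nearly uniform pair of weights \<open>2 ^ (k - 1) - 2\<close> and \<open>2 ^ (k - 1) - 1\<close>, with
  sum \<open>m = 2 ^ k - 3\<close>. Its entropy is at most 1, so it suffices that the expected cost exceeds 3.
  For \<open>k \<le> K \<le> 2 * k - 2\<close> the multiplier \<open>2 ^ K div m\<close> is the power \<open>2 ^ (K - k)\<close>, which merely
  shifts all binary expansions and leaves the tree unchanged; for \<open>K = 2 * k - 1\<close> it is
  \<open>2 ^ (k - 1) + 1\<close>. In both cases the binary expansions can be summed explicitly.

  The expected cost \<open>E\<close> satisfies \<open>E = S + r * E\<close>, where \<open>S\<close> is the mean depth of the frontier
  and \<open>r\<close> the rejection probability. If \<open>E\<close> is infinite, so is the toll; otherwise \<open>E\<close> is
  determined by this equation, and finiteness of \<open>E\<close> gives almost sure termination, so that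
  the output probabilities sum to 1.
\<close>

section \<open>Weighted sums of binary digits\<close>

text \<open>With the notation of the paper, \<open>weighted_depth K a = 2 ^ K * \<nu>(a / 2 ^ K)\<close>.\<close>

definition weighted_depth :: "nat \<Rightarrow> nat \<Rightarrow> nat" where
  "weighted_depth K a = (\<Sum>d\<le>K. d * 2 ^ (K - d) * (a div 2 ^ (K - d) mod 2))"

text \<open>Stripping the last digit leaves the other digits at their depths, while their place
  values double.\<close>

lemma weighted_depth_Suc:
  "weighted_depth (Suc K) a = 2 * weighted_depth K (a div 2) + Suc K * (a mod 2)"
proof -
  have "d * 2 ^ (Suc K - d) * (a div 2 ^ (Suc K - d) mod 2)
      = 2 * (d * 2 ^ (K - d) * (a div 2 div 2 ^ (K - d) mod 2))" if "d \<le> K" for d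
    using that by (simp add: Suc_diff_le div_mult2_eq)
  then have "(\<Sum>d\<le>K. d * 2 ^ (Suc K - d) * (a div 2 ^ (Suc K - d) mod 2)) = 2 * weighted_depth K (a div 2)"
    unfolding weighted_depth_def sum_distrib_left by (intro sum.cong refl) simp
  then show ?thesis by (simp add: weighted_depth_def[of "Suc K"])
qed

lemma weighted_depth_zero [simp]: "weighted_depth K 0 = 0"
  by (simp add: weighted_depth_def)

text \<open>The digits of \<open>y\<close> occupy only the last \<open>n\<close> depths, below those
  of \<open>x\<close>. Nothing carries, so the two blocks contribute independently.\<close>

lemma weighted_depth_split:
  assumes "y < 2 ^ n"
  shows "weighted_depth (K + n) (2 ^ n * x + y) = 2 ^ n * weighted_depth K x + weighted_depth (K + n) y"
  using assms
proof (induction n arbitrary: y)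
  case (Suc n)
  have 1: "(2 ^ Suc n * x + y) div 2 = 2 ^ n * x + y div 2" "(2 ^ Suc n * x + y) mod 2 = y mod 2"
    by (simp_all add: mult.assoc)
  have "y div 2 < 2 ^ n" using Suc.prems by simp
  from Suc.IH[OF this] show ?case by (simp add: weighted_depth_Suc 1 del: power_Suc) simp
qed simp

lemma weighted_depth_scale: "weighted_depth (K + n) (2 ^ n * x) = 2 ^ n * weighted_depth K x"
  using weighted_depth_split[of 0 n K x] by simp

text \<open>The ones sit at depths \<open>j + 1\<close> to \<open>j + n\<close>. The negative terms
  of the closed form are moved to the left, since subtraction of naturals truncates.\<close>

lemma weighted_depth_ones:
  "weighted_depth (j + n) (2 ^ n - 1) + n + j + 2 = (j + 2) * 2 ^ n"
proof (induction n)
  case (Suc n)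
  obtain q :: nat where q: "2 ^ n = Suc q" by (metis not0_implies_Suc power_eq_0_iff zero_neq_numeral)
  have "(2 ^ Suc n - 1 :: nat) div 2 = 2 ^ n - 1" "(2 ^ Suc n - 1 :: nat) mod 2 = 1"
    by (simp_all add: q)
  then show ?case using Suc by (simp add: weighted_depth_Suc)
qed simp

lemma weighted_depth_one: "weighted_depth (Suc K) 1 = Suc K"
  by (simp add: weighted_depth_Suc)

lemma weighted_depth_three: "weighted_depth (Suc (Suc K)) 3 = 3 * K + 4"
  by (simp add: weighted_depth_Suc)

text \<open>At depth \<open>k = n + 2\<close>, with \<open>m = 4 * p - 3\<close>, the number 3 is
  the rejection weight \<open>2 ^ k - m\<close>. The total exceeds \<open>3 * m\<close> by exactly
  3.\<close>

lemma weighted_depth_sum_low: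
  fixes n :: nat
  defines "p \<equiv> (2::nat) ^ n"
  shows "weighted_depth (n + 2) 3 + weighted_depth (n + 2) (2 * p - 2)
    + weighted_depth (n + 2) (2 * p - 1) + 6 = 12 * p"
proof -
  have "weighted_depth (1 + n) (p - 1) + n + 3 = 3 * p"
    using weighted_depth_ones[of 1 n] by (simp add: p_def)
  moreover have "weighted_depth (n + 2) (2 * p - 2) = 2 * weighted_depth (1 + n) (p - 1)"
    using weighted_depth_scale[of "1 + n" 1 "p - 1"] by (simp add: right_diff_distrib')
  moreover have "weighted_depth (n + 2) (2 * p - 1) + n + 4 = 6 * p"
    using weighted_depth_ones[of 1 "Suc n"] by (simp add: p_def)
  moreover have "weighted_depth (n + 2) 3 = 3 * n + 4"
    using weighted_depth_three[of n] by simp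
  ultimately show ?thesis by linarith
qed

text \<open>This is the case of depth \<open>2 * k - 1\<close>: multiplier \<open>2 * p + 1\<close>,
  rejection weight \<open>2 * p + 3\<close>. The digits fall into explicit blocks, and the total
  exceeds three times the sum of the two scaled weights by \<open>6 * p + 3\<close>.\<close>

lemma weighted_depth_sum_high:
  fixes n :: nat
  assumes "1 \<le> n"
  defines "p \<equiv> (2::nat) ^ n"
  shows "weighted_depth (2 * n + 3) (2 * p + 3)
    + weighted_depth (2 * n + 3) ((2 * p + 1) * (2 * p - 2))
    + weighted_depth (2 * n + 3) ((2 * p + 1) * (2 * p - 1)) + 6 = 24 * (p * p)"
proof -
  define v where "v = weighted_depth (1 + n) (p - 1)"
  define w where "w = weighted_depth (2 * n + 2) (p - 1)"
  define z where "z = weighted_depth (2 * n + 3) ((2 * p + 1) * (2 * p - 1))"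
  have KK: "2 * n + 2 = (n + 2) + n" by simp
  have K: "2 * n + 3 = (n + 2) + (n + 1)" by simp
  have p: "2 ^ (n + 1) = 2 * p" "2 \<le> p"
    using assms(1) power_increasing[of 1 n "2::nat"] by (simp_all add: p_def)
  have v: "v + n + 3 = 3 * p"
    using weighted_depth_ones[of 1 n] by (simp add: p_def v_def)
  have w: "w + 2 * n + 4 = (n + 4) * p"
    using weighted_depth_ones[of "n + 2" n] unfolding w_def KK by (simp add: p_def algebra_simps)
  have pp: "2 ^ (2 * n + 2) = 4 * (p * p)"
    unfolding KK power_add p_def by simp
  have "(2 * p + 1) * (2 * p - 1) = 4 * (p * p) - 1"
    by (cases p) (simp_all add: algebra_simps)
  then have z: "z + 2 * n + 5 = 12 * (p * p)"
    using weighted_depth_ones[of 1 "2 * n + 2", unfolded pp] by (simp add: z_def numeral_3_eq_3)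
  \<comment> \<open>The expansion is a one at depth \<open>n + 2\<close> and then the digits of 3;
    the blocks are disjoint because \<open>1 \<le> n\<close> gives \<open>3 < 2 * p\<close>.\<close>
  have a0: "weighted_depth (2 * n + 3) (2 * p + 3) = 2 * p * (n + 2) + 6 * n + 7"
    using weighted_depth_split[of 3 "n + 1" "n + 2" 1] weighted_depth_one[of "n + 1"]
      weighted_depth_three[of "2 * n + 1"] p
    unfolding K[symmetric] p(1) by (simp add: numeral_3_eq_3)
  have s1: "weighted_depth (n + 2) (2 * p - 2) = 2 * v"
    using weighted_depth_scale[of "1 + n" 1 "p - 1"] by (simp add: right_diff_distrib' v_def)
  have s2: "weighted_depth (2 * n + 3) (2 * p - 2) = 2 * w"
    using weighted_depth_scale[of "2 * n + 2" 1 "p - 1"]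
    by (simp add: right_diff_distrib' w_def numeral_3_eq_3)
  \<comment> \<open>Two adjacent copies of the block of \<open>2 * p - 2\<close>: the upper one
    contributes through \<open>v\<close>, the lower one through \<open>w\<close>.\<close>
  have "(2 * p + 1) * (2 * p - 2) = 2 ^ (n + 1) * (2 * p - 2) + (2 * p - 2)"
    unfolding p(1) by (simp only: distrib_right mult_1)
  then have "weighted_depth (2 * n + 3) ((2 * p + 1) * (2 * p - 2)) = 2 * p * (2 * v) + 2 * w"
    using weighted_depth_split[of "2 * p - 2" "n + 1" "n + 2" "2 * p - 2"] p(2) s1 s2
    unfolding K[symmetric] p(1) by simp
  \<comment> \<open>The upper copy enters with the coefficient \<open>4 * p\<close>, so the identity
    for \<open>v\<close> is needed in multiplied form.\<close>
  moreover have "p * v + p * n + 3 * p = 3 * (p * p)"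
    using arg_cong[OF v, of "\<lambda>x. p * x"] by (simp add: algebra_simps)
  ultimately show ?thesis
    using a0 w z unfolding z_def[symmetric] by (simp add: algebra_simps)
qed

section \<open>Expected cost and toll of a tree with back edges\<close>

text \<open>The start \<open>u\<close> is kept apart from the root \<open>T\<close>, to which back
  edges lead, so that induction over subtrees is possible.\<close>

definition cost_from :: "'a ddg \<Rightarrow> 'a ddg \<Rightarrow> bool stream \<Rightarrow> enat" where
  "cost_from T u \<omega> = Inf {enat n | n. \<exists>i. foldl (descend T) u (stake n \<omega>) = Leaf i}"

lemma cost_eq_cost_from: "cost T = cost_from T T"
  by (simp add: fun_eq_iff cost_def cost_from_def position_def)

lemma cost_from_Leaf [simp]: "cost_from T (Leaf i) \<omega> = 0"
proof -
  have "0 \<in> {enat n | n. \<exists>j. foldl (descend T) (Leaf i) (stake n \<omega>) = Leaf j}"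
    by (auto simp: zero_enat_def intro!: exI[of _ "0::nat"])
  then show ?thesis unfolding cost_from_def
    by (metis (mono_tags, lifting) Inf_lower le_zero_eq)
qed

lemma cost_from_Node:
  "cost_from T (Node l r) (b ## \<omega>) = eSuc (cost_from T (descend T (Node l r) b) \<omega>)"
proof -
  let ?S = "\<lambda>u \<omega>. {enat n | n. \<exists>i. foldl (descend T) u (stake n \<omega>) = Leaf i}"
  let ?u = "descend T (Node l r) b"
  have "?S (Node l r) (b ## \<omega>) = eSuc ` ?S ?u \<omega>"
  proof (intro equalityI subsetI)
    fix x assume "x \<in> ?S (Node l r) (b ## \<omega>)"
    then obtain n i where x: "x = enat n" "foldl (descend T) (Node l r) (stake n (b ## \<omega>)) = Leaf i"
      by blast
    then obtain m where "n = Suc m" by (cases n) auto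
    with x have "x = eSuc (enat m)" "foldl (descend T) ?u (stake m \<omega>) = Leaf i"
      by (auto simp: eSuc_enat simp del: descend.simps)
    then show "x \<in> eSuc ` ?S ?u \<omega>" by blast
  next
    fix x assume "x \<in> eSuc ` ?S ?u \<omega>"
    then obtain m i where "x = enat (Suc m)" "foldl (descend T) ?u (stake m \<omega>) = Leaf i"
      by (auto simp: eSuc_enat simp del: descend.simps)
    then show "x \<in> ?S (Node l r) (b ## \<omega>)"
      by (auto intro!: exI[of _ "Suc m"] simp del: descend.simps)
  qed
  \<comment> \<open>The empty set, with infimum infinity, stands for runs that never reach a
    leaf.\<close>
  moreover have "Inf (eSuc ` X) = eSuc (Inf X)" for X
  proof (cases "X = {}")
    case True
    then show ?thesis by (simp add: Inf_enat_def)
  next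
    case False
    show ?thesis
    proof (rule antisym)
      show "Inf (eSuc ` X) \<le> eSuc (Inf X)"
        using False by (intro Inf_lower imageI) (auto simp: Inf_enat_def intro: LeastI)
      show "eSuc (Inf X) \<le> Inf (eSuc ` X)"
        by (intro Inf_greatest) (auto intro: Inf_lower)
    qed
  qed
  ultimately show ?thesis by (simp add: cost_from_def del: descend.simps)
qed

lemma measurable_traversal [measurable]:
  "(\<lambda>\<omega>. foldl (descend T) u (stake n \<omega>)) \<in> measurable coins (count_space UNIV)"
  by measurable

text \<open>A countable infimum of measurable functions, which makes measurability of the cost
  immediate.\<close>

lemma cost_from_altdef:
  "ennreal_of_enat (cost_from T u \<omega>) =
     (INF n. if \<exists>i. foldl (descend T) u (stake n \<omega>) = Leaf i then of_nat n else \<infinity>)"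
proof -
  let ?P = "\<lambda>n. \<exists>i. foldl (descend T) u (stake n \<omega>) = Leaf i"
  show ?thesis
  proof (cases "\<exists>n. ?P n")
    case True
    let ?l = "LEAST n. ?P n"
    have l: "?P ?l" using True by (rule LeastI_ex)
    have le: "?l \<le> n" if "?P n" for n using that by (rule Least_le)
    have "cost_from T u \<omega> = enat ?l" unfolding cost_from_def
      by (rule antisym) (use l le in \<open>auto intro!: Inf_lower Inf_greatest\<close>)
    moreover have "(INF n. if ?P n then of_nat n else (\<infinity>::ennreal)) = of_nat ?l"
    proof (rule antisym)
      show "(INF n. if ?P n then of_nat n else (\<infinity>::ennreal)) \<le> of_nat ?l"
        by (rule INF_lower2[of ?l]) (use l in auto)
      show "of_nat ?l \<le> (INF n. if ?P n then of_nat n else (\<infinity>::ennreal))"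
        by (rule INF_greatest) (use le in auto)
    qed
    ultimately show ?thesis by simp
  next
    case False
    then show ?thesis by (simp add: cost_from_def Inf_enat_def)
  qed
qed

lemma measurable_cost_from [measurable]:
  "(\<lambda>\<omega>. ennreal_of_enat (cost_from T u \<omega>)) \<in> borel_measurable coins"
  unfolding cost_from_altdef by measurable

section \<open>The renewal equation for the expected cost\<close>

primrec mean_depth :: "'a ddg \<Rightarrow> real" where
  "mean_depth (Leaf i) = 0"
| "mean_depth Back = 0"
| "mean_depth (Node l r) = 1 + (mean_depth l + mean_depth r) / 2"

text \<open>\<open>mean_depth\<close> and \<open>back_prob\<close> are the \<open>S\<close> and
  \<open>r\<close> of the equation \<open>E = S + r * E\<close>. Both refer to a single pass, which
  a back edge ends just as a leaf does.\<close>

primrec back_prob :: "'a ddg \<Rightarrow> real" where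
  "back_prob (Leaf i) = 0"
| "back_prob Back = 1"
| "back_prob (Node l r) = (back_prob l + back_prob r) / 2"

lemma mean_depth_nonneg: "0 \<le> mean_depth T"
  by (induction T) auto

lemma back_prob_nonneg: "0 \<le> back_prob T"
  by (induction T) auto

lemma nn_integral_bernoulli_pmf_half:
  "(\<integral>\<^sup>+ b. f b \<partial>measure_pmf (bernoulli_pmf (1/2))) = f True * ennreal (1/2) + f False * ennreal (1/2)"
  by (subst nn_integral_bernoulli_pmf) auto

text \<open>The traversal never stops at \<open>Back\<close>: a step into such a child already lands at the root.\<close>

lemma nn_integral_cost_from:
  "(\<integral>\<^sup>+ \<omega>. ennreal_of_enat (cost_from T (if u = Back then T else u) \<omega>) \<partial>coins)
     = ennreal (mean_depth u) + ennreal (back_prob u) * expected_cost T"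
proof (induction u)
  case (Leaf i)
  then show ?case by simp
next
  case Back
  then show ?case by (simp add: expected_cost_def cost_eq_cost_from)
next
  case (Node l r)
  let ?f = "\<lambda>u \<omega>. ennreal_of_enat (cost_from T (if u = Back then T else u) \<omega>)"
  have "(\<integral>\<^sup>+ \<omega>. ?f (Node l r) \<omega> \<partial>coins)
      = (\<integral>\<^sup>+ b. (\<integral>\<^sup>+ \<omega>. ?f (Node l r) (b ## \<omega>) \<partial>coins) \<partial>measure_pmf (bernoulli_pmf (1/2)))"
    by (rule prob_space.nn_integral_stream_space[OF prob_space_measure_pmf]) measurable
  also have "\<dots> = (\<integral>\<^sup>+ b. (1 + (\<integral>\<^sup>+ \<omega>. ?f (if b then r else l) \<omega> \<partial>coins)) \<partial>measure_pmf (bernoulli_pmf (1/2)))"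
  proof (rule nn_integral_cong)
    fix b
    have "(\<integral>\<^sup>+ \<omega>. ?f (Node l r) (b ## \<omega>) \<partial>coins) = (\<integral>\<^sup>+ \<omega>. 1 + ?f (if b then r else l) \<omega> \<partial>coins)"
      by (simp add: cost_from_Node Let_def)
    also have "\<dots> = 1 + (\<integral>\<^sup>+ \<omega>. ?f (if b then r else l) \<omega> \<partial>coins)"
      by (subst nn_integral_add)
        (auto simp: prob_space.emeasure_space_1[OF prob_space.prob_space_stream_space[OF prob_space_measure_pmf]])
    finally show "(\<integral>\<^sup>+ \<omega>. ?f (Node l r) (b ## \<omega>) \<partial>coins)
      = 1 + (\<integral>\<^sup>+ \<omega>. ?f (if b then r else l) \<omega> \<partial>coins)" .
  qed
  also have "\<dots> = (1 + (ennreal (mean_depth r) + ennreal (back_prob r) * expected_cost T)) * ennreal (1/2)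
      + (1 + (ennreal (mean_depth l) + ennreal (back_prob l) * expected_cost T)) * ennreal (1/2)"
    unfolding nn_integral_bernoulli_pmf_half using Node by (simp only: if_True if_False)
  \<comment> \<open>The bit consumed at the root is counted as \<open>1/2 + 1/2\<close>, one half
    from each branch.\<close>
  also have "\<dots> = ennreal ((1/2 + 1/2) + (mean_depth l * (1/2) + mean_depth r * (1/2)))
      + ennreal (back_prob l * (1/2) + back_prob r * (1/2)) * expected_cost T"
    using mean_depth_nonneg[of l] mean_depth_nonneg[of r] back_prob_nonneg[of l] back_prob_nonneg[of r]
    by (simp only: ennreal_plus ennreal_mult'' distrib_right distrib_left mult_1 mult_1_right add_ac mult_ac
          add_nonneg_nonneg mult_nonneg_nonneg zero_le_divide_1_iff zero_le_numeral)
  also have "\<dots> = ennreal (mean_depth (Node l r)) + ennreal (back_prob (Node l r)) * expected_cost T"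
    by (simp add: field_simps)
  finally show ?case .
qed

text \<open>The start is the root itself. As an equation in \<open>ennreal\<close> it also holds for
  infinite cost; it can be solved for the cost only once that is known to be finite.\<close>

lemma expected_cost_fixpoint:
  "expected_cost T = ennreal (mean_depth T) + ennreal (back_prob T) * expected_cost T"
  using nn_integral_cost_from[of T T] by (simp add: expected_cost_def cost_eq_cost_from)

section \<open>Almost sure termination, the output distribution and its entropy\<close>

lemma foldl_descend_labels:
  assumes "labels u \<subseteq> labels T" "foldl (descend T) u bs = Leaf i"
  shows "i \<in> labels T"
  using assms
proof (induction bs arbitrary: u)
  case (Cons b bs)
  have "labels (descend T u b) \<subseteq> labels T"
    using Cons.prems(1) by (cases u) (auto simp: Let_def)
  then show ?case using Cons.IH Cons.prems(2) by simp
qed auto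

lemma foldl_descend_Leaf [simp]: "foldl (descend T) (Leaf i) bs = Leaf i"
  by (induction bs) auto

text \<open>Leaves are absorbing, so both runs can be compared at time \<open>m + n\<close>. Hence
  the output events of distinct labels are disjoint.\<close>

lemma position_Leaf_unique:
  assumes "position T \<omega> m = Leaf i" "position T \<omega> n = Leaf j"
  shows "i = j"
proof -
  have "position T \<omega> (n + d) = Leaf i" if "position T \<omega> n = Leaf i" for n d i
    using that by (simp add: position_def flip: stake_add)
  then have "position T \<omega> (m + n) = Leaf i" "position T \<omega> (n + m) = Leaf j"
    using assms by blast+
  then show ?thesis by (simp add: add.commute)
qed

lemma finite_labels: "finite (labels T)"
  by (induction T) auto

text \<open>A nonnegative function with finite integral is finite almost everywhere. So a leaf is
  reached almost surely, and the finitely many disjoint output events have total probability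
  1.\<close>

lemma sum_output_prob:
  assumes "expected_cost T \<noteq> \<infinity>"
  shows "(\<Sum>i\<in>labels T. output_prob T i) = 1"
proof -
  interpret prob_space coins by (rule prob_space.prob_space_stream_space[OF prob_space_measure_pmf])
  let ?A = "\<lambda>i. {\<omega>. \<exists>n. position T \<omega> n = Leaf i}"
  have sp: "space coins = UNIV" by (simp add: space_stream_space)
  have [measurable]: "(\<lambda>\<omega>. position T \<omega> n) \<in> measurable coins (count_space UNIV)" for n
    unfolding position_def by measurable
  have "{\<omega> \<in> space coins. \<exists>n. position T \<omega> n = Leaf i} \<in> sets coins" for i
    by measurable
  then have meas: "?A i \<in> sets coins" for i by (simp add: sp)
  have "AE \<omega> in coins. ennreal_of_enat (cost T \<omega>) \<noteq> \<infinity>"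
    using assms unfolding expected_cost_def cost_eq_cost_from
    by (intro nn_integral_PInf_AE) auto
  then have "AE \<omega> in coins. \<omega> \<in> (\<Union>i\<in>labels T. ?A i)"
  proof eventually_elim
    case (elim \<omega>)
    then have "\<exists>n i. position T \<omega> n = Leaf i"
      by (rule contrapos_np) (simp add: cost_def Inf_enat_def)
    then show ?case using foldl_descend_labels[of T T] by (fastforce simp: position_def)
  qed
  then have "prob (\<Union>i\<in>labels T. ?A i) = 1"
    using meas finite_labels by (subst prob_eq_1) auto
  moreover have "prob (\<Union>i\<in>labels T. ?A i) = (\<Sum>i\<in>labels T. prob (?A i))"
    using meas position_Leaf_unique[of T]
    by (intro finite_measure_finite_Union finite_labels) (auto simp: disjoint_family_on_def)
  ultimately show ?thesis by (simp add: output_prob_def)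
qed

text \<open>Gibbs' inequality against the weight 1/2 at every point, that is,
  \<open>ln x \<le> x - 1\<close> at \<open>x = 1 / (2 * p i)\<close>. The errors sum to
  \<open>card S / 2 - 1\<close>, which is at most 0 even if \<open>S\<close> has fewer than two
  elements.\<close>

lemma shannon_entropy_le_1:
  assumes "finite S" "card S \<le> 2" "(\<Sum>i\<in>S. p i) = 1" "\<And>i. i \<in> S \<Longrightarrow> 0 \<le> p i"
  shows "shannon_entropy S p \<le> 1"
proof -
  have "- (p i * ln (p i)) \<le> 1 / 2 - p i + p i * ln 2" if "i \<in> S" for i
  proof (cases "p i = 0")
    case False
    then have pos: "0 < p i" using assms(4)[OF that] by simp
    have "p i * ln (1 / (2 * p i)) \<le> p i * (1 / (2 * p i) - 1)"
      using pos by (intro mult_left_mono ln_le_minus_one) auto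
    then show ?thesis using pos by (simp add: ln_div ln_mult algebra_simps)
  qed simp
  then have "(\<Sum>i\<in>S. - (p i * ln (p i))) \<le> (\<Sum>i\<in>S. 1 / 2 - p i + p i * ln 2)"
    by (rule sum_mono)
  also have "\<dots> = real (card S) / 2 - 1 + ln 2"
    using assms(3) by (simp add: sum.distrib sum_subtractf flip: sum_distrib_right)
  also have "\<dots> \<le> ln 2" using assms(2) by simp
  finally have "- (\<Sum>i\<in>S. p i * ln (p i)) \<le> ln 2" by (simp add: sum_negf)
  then show ?thesis
    by (simp add: shannon_entropy_def log_def field_simps flip: sum_divide_distrib)
qed

text \<open>The last assumption says \<open>S / (1 - r) > 3\<close> without division. The entropy is
  real, so an infinite cost gives an infinite toll.\<close>

lemma toll_gt_2I:
  assumes "card (labels T) \<le> 2" "back_prob T < 1" "3 * (1 - back_prob T) < mean_depth T"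
  shows "2 < toll T"
proof (cases "expected_cost T = \<infinity>")
  case True
  then show ?thesis by (simp add: toll_def)
next
  case False
  then obtain e where e: "expected_cost T = ennreal e" "0 \<le> e"
    by (cases "expected_cost T") auto
  have "ennreal e = ennreal (mean_depth T + back_prob T * e)"
    using expected_cost_fixpoint[of T] e mean_depth_nonneg[of T] back_prob_nonneg[of T]
    by (simp add: ennreal_mult ennreal_plus)
  then have "e = mean_depth T + back_prob T * e"
    using e mean_depth_nonneg[of T] back_prob_nonneg[of T] by (subst (asm) ennreal_inj) auto
  then have "3 * (1 - back_prob T) < e * (1 - back_prob T)"
    using assms(3) by (simp add: algebra_simps)
  then have "3 < e" using assms(2) by (subst (asm) mult_less_cancel_right_pos) auto
  moreover have "shannon_entropy (labels T) (output_prob T) \<le> 1"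
    using assms(1) sum_output_prob[OF False] finite_labels
    by (intro shannon_entropy_le_1) (auto simp: output_prob_def)
  ultimately show ?thesis using e by (simp add: toll_def)
qed

section \<open>Entropy-optimal trees\<close>

lemma height_restart_at [simp]: "height (restart_at j T) = height T"
  by (induction T) auto

lemma mean_depth_restart_at [simp]: "mean_depth (restart_at j T) = mean_depth T"
  by (induction T) auto

lemma labels_restart_at: "labels (restart_at j T) = labels T - {j}"
  by (induction T) auto

lemma leaf_count_eq_0: "height T < d \<Longrightarrow> leaf_count T d i = 0"
  by (induction T arbitrary: d) (auto split: nat.split)

text \<open>Without back edges a deepest frontier node is a leaf. This turns the vanishing of digits
  beyond depth \<open>K\<close> into a bound on the height.\<close>

lemma exists_leaf_at_height:
  "back_free T \<Longrightarrow> \<exists>i\<in>labels T. 0 < leaf_count T (height T) i"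
  by (induction T) (auto simp: max_def)

text \<open>Leaves of a child lie one level deeper in the node, at half the probability. The weight
  \<open>f\<close> covers both uses: constantly 1 for probabilities, the identity for mean
  depths.\<close>

lemma leaf_count_series_Node:
  fixes f :: "nat \<Rightarrow> real"
  shows "(\<Sum>d\<le>Suc N. f d * real (leaf_count (Node l r) d i) / 2 ^ d)
    = ((\<Sum>d\<le>N. f (Suc d) * real (leaf_count l d i) / 2 ^ d)
      + (\<Sum>d\<le>N. f (Suc d) * real (leaf_count r d i) / 2 ^ d)) / 2"
  by (subst sum.atMost_Suc_shift)
    (simp add: sum.distrib[symmetric] sum_divide_distrib add_divide_distrib distrib_left mult.commute)

text \<open>A leaf at depth \<open>d\<close> is reached with probability \<open>1 / 2 ^ d\<close>.
  The cutoff \<open>N\<close> is any bound on the height, so that children of different heights can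
  share one.\<close>

lemma back_prob_restart_at:
  assumes "back_free T" "height T \<le> N"
  shows "back_prob (restart_at j T) = (\<Sum>d\<le>N. real (leaf_count T d j) / 2 ^ d)"
  using assms
proof (induction T arbitrary: N)
  case (Leaf i)
  show ?case by (simp add: sum.atMost_shift)
next
  case (Node l r)
  then obtain N' where "N = Suc N'" by (cases N) auto
  then show ?case
    using Node.IH[of N'] Node.prems leaf_count_series_Node[of "\<lambda>_. 1" l r j N', simplified mult_1]
    by (simp del: sum.atMost_Suc leaf_count.simps)
qed simp

text \<open>The first equation is Kraft's equality for full binary trees. The two are proved
  together: below a node every depth grows by 1, which adds the total mass of each child, known to
  be 1, to its mean depth.\<close>

lemma leaf_count_sums:
  assumes "back_free T" "height T \<le> N" "labels T \<subseteq> I" "finite I"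
  shows "(\<Sum>i\<in>I. \<Sum>d\<le>N. real (leaf_count T d i) / 2 ^ d) = 1 \<and>
    (\<Sum>i\<in>I. \<Sum>d\<le>N. real d * real (leaf_count T d i) / 2 ^ d) = mean_depth T"
  using assms
proof (induction T arbitrary: N)
  case (Leaf j)
  have "(\<Sum>d\<le>N. f d * real (leaf_count (Leaf j) d i) / 2 ^ d) = (if i = j then f 0 else 0)"
    for f :: "nat \<Rightarrow> real" and i
    by (simp add: sum.atMost_shift)
  from this[of "\<lambda>_. 1"] this[of real] show ?case using Leaf by simp
next
  case (Node l r)
  then obtain N' where N: "N = Suc N'" by (cases N) auto
  have l: "(\<Sum>i\<in>I. \<Sum>d\<le>N'. real (leaf_count l d i) / 2 ^ d) = 1"
      "(\<Sum>i\<in>I. \<Sum>d\<le>N'. real d * real (leaf_count l d i) / 2 ^ d) = mean_depth l"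
    and r: "(\<Sum>i\<in>I. \<Sum>d\<le>N'. real (leaf_count r d i) / 2 ^ d) = 1"
      "(\<Sum>i\<in>I. \<Sum>d\<le>N'. real d * real (leaf_count r d i) / 2 ^ d) = mean_depth r"
    using Node N by auto
  have "(\<Sum>i\<in>I. \<Sum>d\<le>N. real (leaf_count (Node l r) d i) / 2 ^ d) = (1 + 1) / 2"
    unfolding N leaf_count_series_Node[of "\<lambda>_. 1", simplified mult_1]
      sum_divide_distrib[symmetric] sum.distrib l r ..
  moreover have "(\<Sum>i\<in>I. \<Sum>d\<le>N. real d * real (leaf_count (Node l r) d i) / 2 ^ d)
      = ((1 + mean_depth l) + (1 + mean_depth r)) / 2"
  proof -
    have "(\<Sum>d\<le>N'. real (Suc d) * real (leaf_count t d i) / 2 ^ d)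
      = (\<Sum>d\<le>N'. real (leaf_count t d i) / 2 ^ d) + (\<Sum>d\<le>N'. real d * real (leaf_count t d i) / 2 ^ d)"
      for t :: "'a ddg" and i
      by (simp add: sum.distrib add_divide_distrib distrib_right)
    then show ?thesis
      unfolding N leaf_count_series_Node sum_divide_distrib[symmetric]
      by (simp add: sum.distrib l r del: of_nat_Suc)
  qed
  ultimately show ?case by (simp add: field_simps)
qed simp

lemma two_power_split: "d \<le> K \<Longrightarrow> (2::real) ^ K = 2 ^ d * 2 ^ (K - d)"
  by (simp flip: power_add)

text \<open>Whichever entropy-optimal tree is chosen, its leaf counts are the binary digits of the
  integers \<open>As\<close>. This determines its mean depth, so later bounds hold for all choices
  at once.\<close>

lemma entropy_optimal_dyadic:
  fixes As :: "nat list"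
  assumes "entropy_optimal (map (\<lambda>a. real a / 2 ^ K) As) U"
  shows "i < length As \<Longrightarrow> d \<le> K \<Longrightarrow> leaf_count U d i = As ! i div 2 ^ (K - d) mod 2"
    and "height U \<le> K"
    and "2 ^ K * mean_depth U = real (\<Sum>a\<leftarrow>As. weighted_depth K a)"
proof -
  have U: "back_free U" "labels U \<subseteq> {..<length As}"
    and digit: "\<And>i d. i < length As \<Longrightarrow>
      int (leaf_count U d i) = binary_digit (int d) (real (As ! i) / 2 ^ K)"
    using assms by (auto simp: entropy_optimal_def)
  have lc: "leaf_count U d i = As ! i div 2 ^ (K - d) mod 2" if "i < length As" "d \<le> K" for i d
    using digit[OF that(1), of d] unfolding binary_digit_dyadic[OF that(2)] by linarith
  show "i < length As \<Longrightarrow> d \<le> K \<Longrightarrow> leaf_count U d i = As ! i div 2 ^ (K - d) mod 2"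
    by (rule lc)
  show h: "height U \<le> K"
  proof (rule ccontr)
    assume "\<not> height U \<le> K"
    moreover obtain i where "i < length As" "0 < leaf_count U (height U) i"
      using exists_leaf_at_height[OF U(1)] U(2) by auto
    ultimately show False
      using digit[of i "height U"] binary_digit_dyadic_0[of K "height U" "As ! i"] by simp
  qed
  have "2 ^ K * mean_depth U
      = (\<Sum>i<length As. \<Sum>d\<le>K. 2 ^ K * (real d * real (leaf_count U d i) / 2 ^ d))"
    using leaf_count_sums[OF U(1) h U(2) finite_lessThan] by (simp only: flip: sum_distrib_left)
  also have "\<dots> = (\<Sum>i<length As. real (weighted_depth K (As ! i)))"
    unfolding weighted_depth_def of_nat_sum
    by (intro sum.cong refl) (simp add: lc two_power_split[of _ K])
  also have "\<dots> = real (\<Sum>a\<leftarrow>As. weighted_depth K a)"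
    by (simp add: sum_list_sum_nth atLeast0LessThan)
  finally show "2 ^ K * mean_depth U = real (\<Sum>a\<leftarrow>As. weighted_depth K a)" .
qed

section \<open>Cost and depth of FLDR trees from integer data\<close>

lemma ceiling_log2_eq:
  assumes "2 ^ K < 2 * M" "M \<le> 2 ^ K"
  shows "\<lceil>log 2 (real M)\<rceil> = int K"
proof -
  have M: "0 < M" using assms(1) by (cases M) auto
  have "real M \<le> 2 ^ K" "2 ^ K < 2 * real M"
    using assms by (metis of_nat_le_iff of_nat_less_iff of_nat_mult of_nat_numeral of_nat_power)+
  then have "log 2 (real M) \<le> real K" "real K < log 2 (2 * real M)"
    using M by (simp_all add: log_le_iff less_log_iff powr_realpow)
  then show ?thesis using M by (intro ceiling_unique) (auto simp: log_mult)
qed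

lemma FLDR_E:
  assumes "T \<in> FLDR ws" "2 ^ K < 2 * sum_list ws" "sum_list ws \<le> 2 ^ K"
  obtains U where "T = restart_at 0 U"
    "entropy_optimal (map (\<lambda>a. real a / 2 ^ K) ((2 ^ K - sum_list ws) # ws)) U"
proof -
  have "fldr_proposal ws = map (\<lambda>a. real a / 2 ^ K) ((2 ^ K - sum_list ws) # ws)"
    using ceiling_log2_eq[OF assms(2,3)] by (simp add: fldr_proposal_def Let_def)
  then show ?thesis using assms(1) that by (auto simp: FLDR_def)
qed

text \<open>After scaling by \<open>2 ^ K\<close>, the mean depth is the sum of weighted depths and
  the acceptance probability is \<open>M\<close>. The last assumption therefore says that their
  quotient exceeds 3.\<close>

lemma FLDR_toll_gt_2:
  fixes ws :: "nat list"
  defines "M \<equiv> sum_list ws"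
  assumes "T \<in> FLDR ws" "length ws = 2" "2 ^ K < 2 * M" "M \<le> 2 ^ K"
    and "3 * M < weighted_depth K (2 ^ K - M) + (\<Sum>a\<leftarrow>ws. weighted_depth K a)"
  shows "2 < toll T"
proof -
  let ?As = "(2 ^ K - M) # ws"
  obtain U where T: "T = restart_at 0 U"
    and U: "entropy_optimal (map (\<lambda>a. real a / 2 ^ K) ?As) U"
    using FLDR_E[OF assms(2,4,5)[unfolded M_def]] unfolding M_def by blast
  have bf: "back_free U" "labels U \<subseteq> {..<3}"
    using U assms(3) by (auto simp: entropy_optimal_def numeral_3_eq_3 numeral_2_eq_2)
  note opt = entropy_optimal_dyadic[OF U]
  \<comment> \<open>Restarting removes the label 0, which leaves one label for each of the two
    weights.\<close>
  have "labels T \<subseteq> {1, 2}" using bf(2) by (auto simp: T labels_restart_at)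
  then have "card (labels T) \<le> card {1, 2 :: nat}" by (intro card_mono) auto
  then have c: "card (labels T) \<le> 2" by simp
  \<comment> \<open>The leaves labelled 0 spell out the binary digits of \<open>2 ^ K - M\<close>,
    which add up to that number again.\<close>
  have "2 ^ K * back_prob T = (\<Sum>d\<le>K. 2 ^ K * (real (leaf_count U d 0) / 2 ^ d))"
    using back_prob_restart_at[OF bf(1) opt(2)] by (simp add: T sum_distrib_left)
  also have "\<dots> = real (\<Sum>d\<le>K. ((2 ^ K - M) div 2 ^ (K - d) mod 2) * 2 ^ (K - d))"
    unfolding of_nat_sum
    by (intro sum.cong refl) (simp add: opt(1) two_power_split[of _ K])
  also have "\<dots> = real (2 ^ K - M)"
    by (subst binary_expansion) (auto simp: less_imp_diff_less)
  also have "\<dots> = 2 ^ K - real M" using assms(5) by (simp add: of_nat_diff)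
  finally have b: "2 ^ K * (1 - back_prob T) = real M" by (simp add: right_diff_distrib)
  have "0 < 2 ^ K * (1 - back_prob T)" unfolding b using assms(4) by (cases M) auto
  then have "back_prob T < 1" by (simp add: zero_less_mult_iff)
  moreover have "2 ^ K * (3 * (1 - back_prob T)) < 2 ^ K * mean_depth T"
  proof -
    have "2 ^ K * (3 * (1 - back_prob T)) = real (3 * M)" unfolding mult.left_commute[of _ 3] b by simp
    also have "\<dots> < real (\<Sum>a\<leftarrow>?As. weighted_depth K a)"
      using assms(6) by (subst of_nat_less_iff) simp
    also have "\<dots> = 2 ^ K * mean_depth T" using opt(3) by (simp add: T)
    finally show ?thesis .
  qed
  then have "3 * (1 - back_prob T) < mean_depth T" by simp
  ultimately show ?thesis using c by (intro toll_gt_2I)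
qed

text \<open>An odd rejection weight has its last digit at depth \<open>K\<close>, so there is a leaf
  labelled 0 that deep. Turning it into a back edge preserves the height.\<close>

lemma FLDR_height:
  fixes ws :: "nat list"
  defines "M \<equiv> sum_list ws"
  assumes "T \<in> FLDR ws" "2 ^ K < 2 * M" "M \<le> 2 ^ K" "odd (2 ^ K - M)"
  shows "height T = K"
proof -
  let ?As = "(2 ^ K - M) # ws"
  obtain U where T: "T = restart_at 0 U"
    and U: "entropy_optimal (map (\<lambda>a. real a / 2 ^ K) ?As) U"
    using FLDR_E[OF assms(2,3,4)[unfolded M_def]] unfolding M_def by blast
  note opt = entropy_optimal_dyadic[OF U]
  have "leaf_count U K 0 \<noteq> 0" using opt(1)[of 0 K] assms(5) by (simp add: odd_iff_mod_2_eq_one del: even_diff_nat)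
  then have "K \<le> height U" using leaf_count_eq_0[of U K 0] by (meson not_le)
  then show ?thesis using opt(2) by (simp add: T)
qed

section \<open>Verification of the witness\<close>

theorem theorem4p18:
  fixes k :: nat
  assumes "4 \<le> k"
  shows "\<exists>ws :: nat list.
    ws \<noteq> [] \<and> (\<forall>a\<in>set ws. 0 < a) \<and> Gcd (set ws) = 1 \<and>
    \<lceil>log 2 (real (sum_list ws))\<rceil> = int k \<and>
    (\<forall>T\<in>FLDR ws. height T = k) \<and>
    (\<forall>K\<in>{k..2 * k - 1}. \<forall>T\<in>ALDR ws K. toll T > 2)"
proof -
  obtain n where k: "k = n + 2" and n: "2 \<le> n"
    using assms that[of "k - 2"] by auto
  define p :: nat where "p = 2 ^ n"
  have p: "4 \<le> p" using power_increasing[OF n, of "2::nat"] by (simp add: p_def)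
  have two_k: "2 ^ k = 4 * p" by (simp add: k p_def)
  let ?ws = "[2 * p - 2, 2 * p - 1]"
  have m: "sum_list ?ws = 4 * p - 3" using p by simp
  have "gcd (2 * p - 2) (2 * p - 1) = gcd (2 * p - 2) (Suc (2 * p - 2))"
    using p by (intro arg_cong2[where f = gcd]) auto
  also have "\<dots> = 1" by (metis coprime_Suc_right_nat coprime_iff_gcd_eq_1)
  finally have gcd: "Gcd (set ?ws) = 1" by simp
  have range: "2 ^ k < 2 * sum_list ?ws" "sum_list ?ws \<le> 2 ^ k" "odd (2 ^ k - sum_list ?ws)"
    unfolding m two_k using p by auto
  have M: "sum_list [c * (2 * p - 2), c * (2 * p - 1)] = c * (4 * p - 3)" for c
  proof -
    have "4 * p - 3 = (2 * p - 2) + (2 * p - 1)" using p by simp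
    then show ?thesis by (simp only: distrib_left sum_list.Cons sum_list.Nil add_0_right)
  qed
  have toll: "2 < toll T" if K: "K \<in> {k..2 * k - 1}" and T: "T \<in> ALDR ?ws K" for K T
  proof (cases "K = 2 * k - 1")
    case False
    define j where "j = K - k"
    \<comment> \<open>Excluding \<open>K = 2 * k - 1\<close> leaves
      \<open>K \<le> 2 * k - 2\<close>, which is exactly \<open>j \<le> n\<close>.\<close>
    have j: "K = (n + 2) + j" "j \<le> n" using K False by (auto simp: j_def k)
    have "(2::nat) ^ j \<le> p" unfolding p_def using j(2) by (intro power_increasing) auto
    \<comment> \<open>Division with remainder: \<open>3 * 2 ^ j \<le> 3 * p < 4 * p - 3\<close>,
      where the strict inequality rests on \<open>4 \<le> k\<close> through
      \<open>p > 3\<close>.\<close>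
    have two_K: "2 ^ K = 2 ^ j * (4 * p - 3) + 3 * 2 ^ j"
      using p by (simp add: j(1) power_add p_def algebra_simps)
    have "2 ^ K div (4 * p - 3) = 2 ^ j"
      unfolding two_K using p \<open>2 ^ j \<le> p\<close> by simp
    then have T': "T \<in> FLDR [2 ^ j * (2 * p - 2), 2 ^ j * (2 * p - 1)]"
      using T unfolding ALDR_def m by simp
    have A0: "2 ^ K - 2 ^ j * (4 * p - 3) = 2 ^ j * 3" unfolding two_K by simp
    have "weighted_depth K (2 ^ j * 3)
        + (\<Sum>a\<leftarrow>[2 ^ j * (2 * p - 2), 2 ^ j * (2 * p - 1)]. weighted_depth K a)
      = 2 ^ j * (weighted_depth (n + 2) 3 + weighted_depth (n + 2) (2 * p - 2)
        + weighted_depth (n + 2) (2 * p - 1))"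
      unfolding j(1) list.map sum_list.Cons sum_list.Nil weighted_depth_scale distrib_left by simp
    moreover have "2 ^ j * (3 * (4 * p - 3)) < 2 ^ j * (weighted_depth (n + 2) 3
        + weighted_depth (n + 2) (2 * p - 2) + weighted_depth (n + 2) (2 * p - 1))"
      using weighted_depth_sum_low[of n] p unfolding p_def[symmetric] by (intro mult_strict_left_mono) auto
    moreover have "length [2 ^ j * (2 * p - 2), 2 ^ j * (2 * p - 1)] = 2" by simp
    \<comment> \<open>This gives \<open>2 ^ K < 2 * M\<close> for the scaled weights, so
      \<open>K\<close> is their FLDR depth.\<close>
    moreover have "3 * 2 ^ j < 2 ^ j * (4 * p - 3)"
      using p mult_strict_left_mono[of 3 "4 * p - 3" "2 ^ j"] by simp
    ultimately show ?thesis
      using FLDR_toll_gt_2[OF T', unfolded M, of K, unfolded A0] two_K by linarith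
  next
    case True
    then have K: "K = n + n + 3" by (simp add: k)
    have two_K: "2 ^ K = 8 * (p * p)" unfolding K power_add p_def by simp
    have pp: "4 * p \<le> p * p" using p by simp
    \<comment> \<open>Again division with remainder: \<open>2 * p + 3 < 4 * p - 3\<close> because
      \<open>p > 3\<close>. At this depth the quotient first differs from a power of two.\<close>
    have cm: "(2 * p + 1) * (4 * p - 3) + (2 * p + 3) = 8 * (p * p)"
      using p by (cases p) (auto simp: algebra_simps)
    have "2 ^ K div (4 * p - 3) = 2 * p + 1"
      unfolding two_K cm[symmetric] using p by (subst div_mult_self3) auto
    then have T': "T \<in> FLDR [(2 * p + 1) * (2 * p - 2), (2 * p + 1) * (2 * p - 1)]"
      using T unfolding ALDR_def m by simp
    have A0: "8 * (p * p) - (2 * p + 1) * (4 * p - 3) = 2 * p + 3" using cm by linarith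
    have K': "K = 2 * n + 3" by (simp add: K)
    have "weighted_depth K (2 * p + 3)
        + (\<Sum>a\<leftarrow>[(2 * p + 1) * (2 * p - 2), (2 * p + 1) * (2 * p - 1)]. weighted_depth K a) + 6
      = 24 * (p * p)"
      using weighted_depth_sum_high[of n] n
      unfolding K' p_def list.map sum_list.Cons sum_list.Nil by linarith
    moreover have "length [(2 * p + 1) * (2 * p - 2), (2 * p + 1) * (2 * p - 1)] = 2" by simp
    ultimately show ?thesis
      using FLDR_toll_gt_2[OF T', unfolded M, of K, unfolded two_K A0] cm pp p by linarith
  qed
  show ?thesis
    using p gcd ceiling_log2_eq[OF range(1,2)] FLDR_height[OF _ range] toll
    by (intro exI[of _ ?ws]) auto
qed

end
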